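(* Let $(\mathcal X,\mathcal B,\mu)$ be a $\sigma$-finite measure space and $\mathcal I$ a countable, measurable partition of $\mathcal X$ into blocks of positive measure. Let $\mathcal X_0=\bigcup\{I\in\mathcal I:\mu(I)<+\infty\}$ and, for $h>0$, $M(h)=|\{I\in\mathcal I:\mu(I)\le h\}|$. For $L>0$ and $n\ge1$ define $\psi_n(\mathcal I,L)\geq 0$ by $$\psi_n(\mathcal I,L)^2=\sup_{h>0}\left\{\frac L{hn}\log\left(1+\min\Bigl(M(h),\Bigl\lfloor\frac1{Lh}\Bigr\rfloor\Bigr)\right)\right\}.$$ Then for any $\theta\in(\frac12,1)$ and any $L\ge\frac1{\theta\mu(\mathcal X_0)}$, $$\inf_{\hat p}\ \sup_{p^\star\in m_L(0,\mathcal I)}\mathbb E\bigl[\|\hat p-p^\star\|_{\infty,\mu}\bigr]\ge\frac1{40}\min\left((1-\theta)L,\ \sqrt{\theta(1-\theta)}\,\psi_n(\mathcal I,L)\right),$$ where the infimum runs over all estimators $\hat p$ of $p^\star$ based on an i.i.d. sample of size $n$ drawn from $p^\star$.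
   Context: $\|\cdot\|_{\infty,\mu}$ is the $\mu$-essential supremum norm. $m_L(0,\mathcal I)=\{\sum_{I\in\mathcal I}c_I\mathbf 1_I:\ c\in[0,L]^{\mathcal I},\ \sum_{I\in\mathcal I}c_I\mu(I)=1\}$ is the class of probability densities (with respect to $\mu$) that are constant on the blocks of $\mathcal I$ and bounded by $L$ (with $0\cdot\infty=0$). Conventions: $1/\infty=0$; $M(h)$ and $\psi_n(\mathcal I,L)$ may be $+\infty$. *)

theory Defs
  imports "HOL-Probability.Probability"
begin

definition Linf_norm :: "'a measure \<Rightarrow> ('a \<Rightarrow> real) \<Rightarrow> ennreal" where
  "Linf_norm M f = esssup M (\<lambda>x. ennreal \<bar>f x\<bar>)"

text \<open>
  A class of densities that are constant on the blocks and bounded by \<open>L\<close>. The normalisation is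
  an identity between extended nonnegative numbers, where \<open>0 * \<infinity> = 0\<close>; blocks of infinite
  measure are thus allowed, and are forced to carry the coefficient \<open>0\<close>.
\<close>
definition block_densities :: "'a measure \<Rightarrow> 'a set set \<Rightarrow> real \<Rightarrow> ('a \<Rightarrow> real) set" where
  "block_densities M \<I> L =
     {(\<lambda>x. \<Sum>\<^sub>\<infinity>I\<in>\<I>. c I * indicator I x) | c.
        c \<in> \<I> \<rightarrow> {0..L} \<and> (\<Sum>\<^sub>\<infinity>I\<in>\<I>. ennreal (c I) * emeasure M I) = 1}"

definition finite_part :: "'a measure \<Rightarrow> 'a set set \<Rightarrow> 'a set" where
  "finite_part M \<I> = \<Union>{I \<in> \<I>. emeasure M I < \<infinity>}"

text \<open>The number of blocks of measure at most \<open>h\<close>, which may be infinite.\<close>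
definition num_blocks :: "'a measure \<Rightarrow> 'a set set \<Rightarrow> real \<Rightarrow> ennreal" where
  "num_blocks M \<I> h = emeasure (count_space UNIV) {I \<in> \<I>. emeasure M I \<le> ennreal h}"

text \<open>The minimum below is always finite, so that \<^const>\<open>enn2real\<close> loses nothing.\<close>
definition psi_sq :: "'a measure \<Rightarrow> nat \<Rightarrow> 'a set set \<Rightarrow> real \<Rightarrow> ennreal" where
  "psi_sq M n \<I> L =
     (SUP h\<in>{0<..}. ennreal (L / (h * real n) *
        ln (1 + enn2real (min (num_blocks M \<I> h) (of_nat (nat \<lfloor>1 / (L * h)\<rfloor>))))))"

definition psi :: "'a measure \<Rightarrow> nat \<Rightarrow> 'a set set \<Rightarrow> real \<Rightarrow> ennreal" where
  "psi M n \<I> L =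
     (if psi_sq M n \<I> L = \<infinity> then \<infinity> else ennreal (sqrt (enn2real (psi_sq M n \<I> L))))"

lemma psi_power2: "(psi M n \<I> L)\<^sup>2 = psi_sq M n \<I> L"
  by (cases "psi_sq M n \<I> L")
     (auto simp: psi_def ennreal_power power2_eq_square ennreal_top_mult ennreal_mult'[symmetric])

text \<open>
  The law of \<open>n\<close> i.i.d. observations with density \<open>p\<close> with respect to \<open>M\<close>. Its measurable space is
  that of \<open>PiM {..<n} (\<lambda>_. M)\<close>, for every \<open>p\<close>.
\<close>
definition sample_law :: "'a measure \<Rightarrow> nat \<Rightarrow> ('a \<Rightarrow> real) \<Rightarrow> (nat \<Rightarrow> 'a) measure" where
  "sample_law M n p = PiM {..<n} (\<lambda>_. density M (\<lambda>x. ennreal (p x)))"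

text \<open>
  Estimators of a function on \<open>M\<close> from \<open>n\<close> observations. The measurability conditions are the
  weakest ones under which all the expected losses over the class \<open>P\<close> are meaningful; the
  estimators need not be densities nor belong to \<open>P\<close>. Jointly measurable maps are included, see
  \<open>estimatorsI\<close> below.
\<close>
definition estimators ::
    "'a measure \<Rightarrow> nat \<Rightarrow> ('a \<Rightarrow> real) set \<Rightarrow> ((nat \<Rightarrow> 'a) \<Rightarrow> 'a \<Rightarrow> real) set" where
  "estimators M n P =
     {q. (\<forall>\<omega>\<in>space (PiM {..<n} (\<lambda>_. M)). q \<omega> \<in> borel_measurable M) \<and>
         (\<forall>p\<in>P. (\<lambda>\<omega>. Linf_norm M (\<lambda>x. q \<omega> x - p x)) \<in> borel_measurable (PiM {..<n} (\<lambda>_. M)))}"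

definition sup_risk ::
    "'a measure \<Rightarrow> nat \<Rightarrow> ('a \<Rightarrow> real) set \<Rightarrow> ((nat \<Rightarrow> 'a) \<Rightarrow> 'a \<Rightarrow> real) \<Rightarrow> ennreal" where
  "sup_risk M n P q = (SUP p\<in>P. \<integral>\<^sup>+\<omega>. Linf_norm M (\<lambda>x. q \<omega> x - p x) \<partial>sample_law M n p)"

definition minimax_risk :: "'a measure \<Rightarrow> nat \<Rightarrow> ('a \<Rightarrow> real) set \<Rightarrow> ennreal" where
  "minimax_risk M n P = (INF q\<in>estimators M n P. sup_risk M n P q)"

lemma estimatorsI:
  assumes "sigma_finite_measure M" and P: "P \<subseteq> borel_measurable M"
    and q[measurable]: "case_prod q \<in> borel_measurable (PiM {..<n} (\<lambda>_. M) \<Otimes>\<^sub>M M)"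
  shows "q \<in> estimators M n P"
  unfolding estimators_def
proof (intro CollectI conjI ballI)
  interpret sigma_finite_measure M by fact
  let ?S = "PiM {..<n} (\<lambda>_. M)"
  show sec: "q \<omega> \<in> borel_measurable M" if "\<omega> \<in> space ?S" for \<omega>
    using measurable_compose[OF measurable_Pair1'[OF that] q] by simp
  fix p assume "p \<in> P"
  then have p[measurable]: "p \<in> borel_measurable M" using P by auto
  let ?f = "\<lambda>\<omega> x. ennreal \<bar>q \<omega> x - p x\<bar>"
  have f: "?f \<omega> \<in> borel_measurable M" if "\<omega> \<in> space ?S" for \<omega>
    using sec[OF that] by measurable
  show "(\<lambda>\<omega>. Linf_norm M (\<lambda>x. q \<omega> x - p x)) \<in> borel_measurable ?S"
    unfolding Linf_norm_def
  proof (rule borel_measurableI_greater)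
    fix t :: ennreal
    have iff: "t < esssup M (?f \<omega>) \<longleftrightarrow> emeasure M {x \<in> space M. t < ?f \<omega> x} \<noteq> 0"
      if w: "\<omega> \<in> space ?S" for \<omega>
    proof
      assume "t < esssup M (?f \<omega>)"
      then show "emeasure M {x \<in> space M. t < ?f \<omega> x} \<noteq> 0"
        using esssup_pos_measure[OF f[OF w]] by (metis not_gr_zero)
    next
      assume *: "emeasure M {x \<in> space M. t < ?f \<omega> x} \<noteq> 0"
      show "t < esssup M (?f \<omega>)"
      proof (rule ccontr)
        assume "\<not> t < esssup M (?f \<omega>)"
        then have "AE x in M. ?f \<omega> x \<le> t"
          using esssup_AE[of "?f \<omega>" M] by (auto elim!: eventually_mono intro: order_trans)
        then have "emeasure M {x \<in> space M. \<not> ?f \<omega> x \<le> t} = 0"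
          using f[OF w] by (subst (asm) AE_iff_measurable[OF _ refl]) auto
        with * show False by (simp add: not_le)
      qed
    qed
    have [measurable]: "{z \<in> space (?S \<Otimes>\<^sub>M M). t < (case z of (\<omega>, x) \<Rightarrow> ?f \<omega> x)} \<in> sets (?S \<Otimes>\<^sub>M M)"
      by measurable
    have "(\<lambda>\<omega>. emeasure M (Pair \<omega> -` {z \<in> space (?S \<Otimes>\<^sub>M M). t < (case z of (\<omega>, x) \<Rightarrow> ?f \<omega> x)}))
        \<in> borel_measurable ?S"
      by (rule measurable_emeasure_Pair) measurable
    also have "?this \<longleftrightarrow> (\<lambda>\<omega>. emeasure M {x \<in> space M. t < ?f \<omega> x}) \<in> borel_measurable ?S"
      by (rule measurable_cong) (auto intro!: arg_cong[where f="emeasure M"] simp: space_pair_measure)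
    finally have [measurable]: "(\<lambda>\<omega>. emeasure M {x \<in> space M. t < ?f \<omega> x}) \<in> borel_measurable ?S" .
    have "{\<omega> \<in> space ?S. t < esssup M (?f \<omega>)}
        = {\<omega> \<in> space ?S. emeasure M {x \<in> space M. t < ?f \<omega> x} \<noteq> 0}"
      using iff by auto
    also have "\<dots> \<in> sets ?S" by measurable
    finally show "{\<omega> \<in> space ?S. t < esssup M (?f \<omega>)} \<in> sets ?S" .
  qed
qed

end

theory Submission
  imports Defs
begin

text \<open>
  Fix \<open>h\<close> and \<open>N = min (M(h)) \<lfloor>1/(L h)\<rfloor>\<close> blocks of measure at most \<open>h\<close>. The null density \<open>p\<^sub>0\<close> equals
  \<open>\<theta> L\<close> on these blocks and a constant \<open>\<kappa> \<le> \<theta> L\<close> on a union \<open>W\<close> of other blocks of finite measure;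
  \<open>W\<close> carries mass \<open>r \<ge> 1 - \<theta>\<close>. The alternative \<open>p\<^sub>I\<close> adds \<open>\<delta>\<close> on the single block \<open>I\<close> and takes the
  mass back proportionally from \<open>W\<close>, so all alternatives are at distance at least \<open>\<delta>\<close> from \<open>p\<^sub>0\<close>.
  If \<open>Z\<close> is the average of the \<open>N\<close> likelihood ratios and \<open>R\<close> the maximal risk, then
  \<open>2 R \<ge> \<delta> E\<^sub>0[min 1 Z] \<ge> \<delta> (1 - E\<^sub>0[Z\<^sup>2] / 4)\<close>. For \<open>n \<delta>\<^sup>2 h\<close> at most
  \<open>L \<theta> (1 - \<theta>) ln (1 + N) / 4\<close>, each of the \<open>N\<close> diagonal terms of \<open>E\<^sub>0[(N Z)\<^sup>2]\<close> is at most \<open>1 + N\<close>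
  and each off-diagonal term at most \<open>3/2\<close>, so \<open>E\<^sub>0[Z\<^sup>2]\<close> is at most \<open>18/5\<close>.
\<close>

section \<open>Product measures and block densities\<close>

text \<open>Both sides agree on measurable boxes, where the indicator of the box factors over the
  coordinates and Tonelli splits the integral. Sigma-finiteness of \<open>density M f\<close> is
  what makes the product measure on the left determined by its boxes. This turns the law of a sample
  into a likelihood ratio times a fixed product law.\<close>

lemma PiM_density:
  fixes f :: "'a \<Rightarrow> ennreal"
  assumes I: "finite I" and M: "sigma_finite_measure M" and f[measurable]: "f \<in> borel_measurable M"
    and Mf: "sigma_finite_measure (density M f)"
  shows "PiM I (\<lambda>_. density M f) = density (PiM I (\<lambda>_. M)) (\<lambda>\<omega>. \<Prod>i\<in>I. f (\<omega> i))"
proof -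
  interpret M: product_sigma_finite "\<lambda>_. M" using M by (simp add: product_sigma_finite_def)
  interpret Mf: product_sigma_finite "\<lambda>_. density M f"
    using Mf by (simp add: product_sigma_finite_def)
  have "density (PiM I (\<lambda>_. M)) (\<lambda>\<omega>. \<Prod>i\<in>I. f (\<omega> i)) = PiM I (\<lambda>_. density M f)"
  proof (rule Mf.PiM_eqI[OF I])
    show "sets (density (PiM I (\<lambda>_. M)) (\<lambda>\<omega>. \<Prod>i\<in>I. f (\<omega> i))) = sets (PiM I (\<lambda>_. density M f))"
      unfolding sets_density by (rule sets_PiM_cong) auto
    fix A assume "\<And>i. i \<in> I \<Longrightarrow> A i \<in> sets (density M f)"
    then have A[measurable]: "\<And>i. i \<in> I \<Longrightarrow> A i \<in> sets M" by simp
    have "emeasure (density (PiM I (\<lambda>_. M)) (\<lambda>\<omega>. \<Prod>i\<in>I. f (\<omega> i))) (PiE I A)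
        = (\<integral>\<^sup>+\<omega>. (\<Prod>i\<in>I. f (\<omega> i)) * indicator (PiE I A) \<omega> \<partial>PiM I (\<lambda>_. M))"
      using A I by (intro emeasure_density sets_PiM_I_finite) measurable
    also have "\<dots> = (\<integral>\<^sup>+\<omega>. (\<Prod>i\<in>I. f (\<omega> i) * indicator (A i) (\<omega> i)) \<partial>PiM I (\<lambda>_. M))"
    proof (rule nn_integral_cong)
      fix \<omega> assume w: "\<omega> \<in> space (PiM I (\<lambda>_. M))"
      have "indicator (PiE I A) \<omega> = (\<Prod>i\<in>I. indicator (A i) (\<omega> i) :: ennreal)"
      proof (cases "\<omega> \<in> PiE I A")
        case True
        then show ?thesis by (simp add: PiE_mem)
      next
        case False
        then obtain i where "i \<in> I" "\<omega> i \<notin> A i" using w by (auto simp: space_PiM PiE_iff)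
        then show ?thesis using False I by (simp add: prod_zero_iff[OF I] bexI[of _ i])
      qed
      then show "(\<Prod>i\<in>I. f (\<omega> i)) * indicator (PiE I A) \<omega>
          = (\<Prod>i\<in>I. f (\<omega> i) * indicator (A i) (\<omega> i))"
        by (simp add: prod.distrib)
    qed
    also have "\<dots> = (\<Prod>i\<in>I. \<integral>\<^sup>+x. f x * indicator (A i) x \<partial>M)"
      using A by (intro M.product_nn_integral_prod I) measurable
    also have "\<dots> = (\<Prod>i\<in>I. emeasure (density M f) (A i))"
      using A by (intro prod.cong) (auto simp: emeasure_density)
    finally show "emeasure (density (PiM I (\<lambda>_. M)) (\<lambda>\<omega>. \<Prod>i\<in>I. f (\<omega> i))) (PiE I A)
      = (\<Prod>i\<in>I. emeasure (density M f) (A i))" .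
  qed
  then show ?thesis ..
qed

text \<open>Both quantities are limits of finite partial sums. The bridge lets the series that
  normalises \<open>block_densities\<close> be treated as an integral and exchanged with the
  integral over \<open>M\<close>.\<close>

lemma infsum_ennreal_eq_nn_integral:
  fixes f :: "'a \<Rightarrow> ennreal"
  assumes A: "countable A"
  shows "infsum f A = (\<integral>\<^sup>+x. f x \<partial>count_space A)"
proof (rule antisym)
  show "infsum f A \<le> (\<integral>\<^sup>+x. f x \<partial>count_space A)"
    unfolding nonneg_infsum_complete[of A f, OF zero_le]
  proof (rule SUP_least)
    fix F assume F: "F \<in> {F. finite F \<and> F \<subseteq> A}"
    then have "sum f F = (\<integral>\<^sup>+x. f x * indicator F x \<partial>count_space A)"
      by (subst nn_integral_count_space'[of F]) (auto simp: indicator_def)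
    also have "\<dots> \<le> (\<integral>\<^sup>+x. f x \<partial>count_space A)"
      by (intro nn_integral_mono) (auto simp: indicator_def)
    finally show "sum f F \<le> (\<integral>\<^sup>+x. f x \<partial>count_space A)" .
  qed
  show "(\<integral>\<^sup>+x. f x \<partial>count_space A) \<le> infsum f A"
  proof (cases "finite A")
    case True
    then show ?thesis by (simp add: nn_integral_count_space_finite)
  next
    case False
    note bij = bij_betw_from_nat_into[OF A False]
    have "(\<integral>\<^sup>+x. f x \<partial>count_space A) = (\<Sum>i. f (from_nat_into A i))"
      by (simp add: nn_integral_bij_count_space[OF bij, symmetric] nn_integral_count_space_nat)
    also have "\<dots> \<le> infsum f A"
    proof (rule suminf_le_const)
      fix k
      have "(\<Sum>i<k. f (from_nat_into A i)) = sum f (from_nat_into A ` {..<k})"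
        using bij by (subst sum.reindex) (auto simp: bij_betw_def intro: inj_on_subset)
      also have "\<dots> \<le> infsum f A"
        unfolding nonneg_infsum_complete[of A f, OF zero_le]
        using False by (intro SUP_upper) (auto intro!: from_nat_into)
      finally show "(\<Sum>i<k. f (from_nat_into A i)) \<le> infsum f A" .
    qed simp
    finally show ?thesis .
  qed
qed

text \<open>Each point of the space lies in exactly one block, so the series defining the density
  has a single nonzero term there. The normalisation then reduces to the condition that
  \<open>f\<close> integrates to one, which is easier to verify for concrete densities.\<close>

lemma block_densitiesI:
  assumes \<I>: "countable \<I>" "partition_on (space M) \<I>" "\<I> \<subseteq> sets M"
    and c: "c \<in> \<I> \<rightarrow> {0..L}"
    and f: "\<And>I x. I \<in> \<I> \<Longrightarrow> x \<in> I \<Longrightarrow> f x = c I" "\<And>x. x \<notin> space M \<Longrightarrow> f x = 0"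
    and f1: "(\<integral>\<^sup>+x. ennreal (f x) \<partial>M) = 1"
  shows "f \<in> block_densities M \<I> L"
proof -
  have U: "\<Union>\<I> = space M" and disj: "disjoint \<I>"
    using \<I>(2) by (auto simp: partition_on_def)
  have uniq: "J = I" if "I \<in> \<I>" "J \<in> \<I>" "x \<in> I" "x \<in> J" for I J x
    using disj that by (auto simp: disjoint_def)
  have sums: "(\<Sum>\<^sub>\<infinity>I\<in>\<I>. c I * indicator I x) = f x
      \<and> (\<Sum>\<^sub>\<infinity>I\<in>\<I>. ennreal (c I) * indicator I x) = ennreal (f x)" for x
  proof (cases "x \<in> space M")
    case True
    then obtain I where I: "I \<in> \<I>" "x \<in> I" using U by auto
    have zero: "x \<notin> J" if "J \<in> \<I> - {I}" for J
      using uniq[OF I(1) _ I(2), of J] that by blast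
    have "(\<Sum>\<^sub>\<infinity>J\<in>\<I>. c J * indicator J x) = (\<Sum>\<^sub>\<infinity>J\<in>{I}. c J * indicator J x)"
      using I(1) zero by (intro infsum_cong_neutral) simp_all
    moreover have "(\<Sum>\<^sub>\<infinity>J\<in>\<I>. ennreal (c J) * indicator J x)
        = (\<Sum>\<^sub>\<infinity>J\<in>{I}. ennreal (c J) * indicator J x)"
      using I(1) zero by (intro infsum_cong_neutral) simp_all
    ultimately show ?thesis using I by (simp add: f(1))
  next
    case False
    then have "x \<notin> I" if "I \<in> \<I>" for I using U that by auto
    then show ?thesis using False by (auto simp: f(2) intro!: infsum_0)
  qed
  have "(\<Sum>\<^sub>\<infinity>I\<in>\<I>. ennreal (c I) * emeasure M I)
      = (\<integral>\<^sup>+I. (\<integral>\<^sup>+x. ennreal (c I) * indicator I x \<partial>M) \<partial>count_space \<I>)"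
    unfolding infsum_ennreal_eq_nn_integral[OF \<I>(1)]
    using \<I>(3) by (intro nn_integral_cong) (auto simp: nn_integral_cmult_indicator)
  \<comment> \<open>Exchange of a countable sum with the integral of nonnegative functions.\<close>
  also have "\<dots> = (\<integral>\<^sup>+x. (\<integral>\<^sup>+I. ennreal (c I) * indicator I x \<partial>count_space \<I>) \<partial>M)"
    using \<I>(3) by (intro nn_integral_count_space_nn_integral[symmetric] \<I>(1)) auto
  also have "\<dots> = 1"
    using sums by (simp add: infsum_ennreal_eq_nn_integral[OF \<I>(1), symmetric] f1)
  finally have "(\<Sum>\<^sub>\<infinity>I\<in>\<I>. ennreal (c I) * emeasure M I) = 1" .
  moreover have "f = (\<lambda>x. \<Sum>\<^sub>\<infinity>I\<in>\<I>. c I * indicator I x)" using sums by auto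
  ultimately show ?thesis using c unfolding block_densities_def by blast
qed

lemma emeasure_Union_disjoint:
  assumes "countable \<U>" "\<U> \<subseteq> sets M" "disjoint \<U>"
  shows "emeasure M (\<Union>\<U>) = (\<Sum>\<^sub>\<infinity>I\<in>\<U>. emeasure M I)"
  using emeasure_UN_countable[of \<U> "\<lambda>I. I" M] assms
  by (auto simp: infsum_ennreal_eq_nn_integral disjoint_family_on_def disjoint_def)

text \<open>Needed because the blocks of finite measure may have infinite total measure.\<close>
lemma subfamily_finite_mass:
  assumes \<T>: "countable \<T>" "\<T> \<subseteq> sets M" "disjoint \<T>"
    and fin: "\<And>I. I \<in> \<T> \<Longrightarrow> emeasure M I < \<infinity>"
    and t: "ennreal t \<le> emeasure M (\<Union>\<T>)"
  obtains \<U> where "\<U> \<subseteq> \<T>" "ennreal t \<le> emeasure M (\<Union>\<U>)" "emeasure M (\<Union>\<U>) < \<infinity>"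
proof (cases "emeasure M (\<Union>\<T>) < \<infinity>")
  case True
  then show ?thesis using t that by blast
next
  case False
  then have "ennreal t < (\<Sum>\<^sub>\<infinity>I\<in>\<T>. emeasure M I)"
    using emeasure_Union_disjoint[OF \<T>] by (metis ennreal_less_top infinity_ennreal_def top.not_eq_extremum)
  \<comment> \<open>The measures of the blocks have an infinite sum, so some finite partial sum
    already exceeds \<open>t\<close>, and a finite union of blocks of finite measure has finite
    measure.\<close>
  then obtain F where F: "finite F" "F \<subseteq> \<T>" "ennreal t < (\<Sum>I\<in>F. emeasure M I)"
    by (auto simp: nonneg_infsum_complete less_SUP_iff)
  have "emeasure M (\<Union>F) = (\<Sum>I\<in>F. emeasure M I)"
    using emeasure_Union_disjoint[of F M] F \<T>
    by (auto simp: countable_finite disjoint_def subset_iff)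
  moreover have "(\<Sum>I\<in>F. emeasure M I) < \<infinity>"
    using F fin by (auto simp: less_top)
  ultimately show ?thesis using F that[of F] by auto
qed

text \<open>The estimate \<open>q\<close> is the middle point: it cannot be close to two densities
  that are far apart, which yields the separation hypothesis of the mixture bound.\<close>

lemma Linf_norm_triangle:
  assumes [measurable]: "f \<in> borel_measurable M" "g \<in> borel_measurable M" "q \<in> borel_measurable M"
  shows "Linf_norm M (\<lambda>x. f x - g x) \<le> Linf_norm M (\<lambda>x. q x - f x) + Linf_norm M (\<lambda>x. q x - g x)"
  unfolding Linf_norm_def
proof (rule esssup_I)
  show "AE x in M. ennreal \<bar>f x - g x\<bar>
      \<le> esssup M (\<lambda>x. ennreal \<bar>q x - f x\<bar>) + esssup M (\<lambda>x. ennreal \<bar>q x - g x\<bar>)"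
    using esssup_AE[of "\<lambda>x. ennreal \<bar>q x - f x\<bar>" M] esssup_AE[of "\<lambda>x. ennreal \<bar>q x - g x\<bar>" M]
  proof eventually_elim
    case (elim x)
    have "ennreal \<bar>f x - g x\<bar> \<le> ennreal (\<bar>q x - f x\<bar> + \<bar>q x - g x\<bar>)" by (rule ennreal_leI) linarith
    also have "\<dots> = ennreal \<bar>q x - f x\<bar> + ennreal \<bar>q x - g x\<bar>" by simp
    finally show ?case using add_mono[OF elim] by (rule order_trans)
  qed
qed measurable

text \<open>A smaller norm would force almost every point to lie outside \<open>A\<close>. Since
  blocks have positive measure, a change on a single block is visible to the essential
  supremum.\<close>

lemma Linf_norm_ge:
  assumes [measurable]: "f \<in> borel_measurable M" and A: "A \<in> sets M" "emeasure M A > 0"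
    and d: "\<And>x. x \<in> A \<Longrightarrow> d \<le> \<bar>f x\<bar>"
  shows "ennreal d \<le> Linf_norm M f"
proof (rule ccontr)
  assume "\<not> ?thesis"
  then have less: "Linf_norm M f < ennreal d" by simp
  have "AE x in M. ennreal \<bar>f x\<bar> \<le> Linf_norm M f"
    unfolding Linf_norm_def by (rule esssup_AE)
  then have "AE x in M. x \<notin> A"
  proof eventually_elim
    case (elim x)
    show ?case
    proof
      assume "x \<in> A"
      then have "ennreal d \<le> ennreal \<bar>f x\<bar>" by (intro ennreal_leI d)
      with elim less show False by (meson leD le_less_trans)
    qed
  qed
  then have "emeasure M A = 0" using A by (subst (asm) AE_iff_measurable[of A]) (auto dest: sets.sets_into_space)
  with A show False by simp
qed

section \<open>Second moment method for one hypothesis against a mixture\<close>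

text \<open>
  The form in \<open>K\<close> comes from \<open>min 1 z \<ge> z - z\<^sup>2 / 4\<close>; keeping the losses instead of a test avoids the
  factor \<open>2\<close> of Markov's inequality.
\<close>
lemma mixture_lower_bound:
  fixes lik :: "'b \<Rightarrow> 'w \<Rightarrow> real" and loss :: "'b \<Rightarrow> 'w \<Rightarrow> ennreal" and base_loss :: "'w \<Rightarrow> ennreal" and K :: real
  assumes S: "finite S" "S \<noteq> {}"
    and meas[measurable]: "base_loss \<in> borel_measurable Q"
      "\<And>I. I \<in> S \<Longrightarrow> lik I \<in> borel_measurable Q" "\<And>I. I \<in> S \<Longrightarrow> loss I \<in> borel_measurable Q"
    and nonneg: "\<And>I \<omega>. I \<in> S \<Longrightarrow> \<omega> \<in> space Q \<Longrightarrow> 0 \<le> lik I \<omega>"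
    and lik1: "\<And>I. I \<in> S \<Longrightarrow> (\<integral>\<^sup>+\<omega>. ennreal (lik I \<omega>) \<partial>Q) = 1"
    and \<delta>: "0 \<le> \<delta>"
    and K: "(\<Sum>I\<in>S. \<Sum>J\<in>S. \<integral>\<^sup>+\<omega>. ennreal (lik I \<omega> * lik J \<omega>) \<partial>Q) \<le> ennreal (K * (card S)\<^sup>2)" "0 \<le> K"
    and sep: "\<And>I \<omega>. I \<in> S \<Longrightarrow> \<omega> \<in> space Q \<Longrightarrow> ennreal \<delta> \<le> base_loss \<omega> + loss I \<omega>"
    and R0: "(\<integral>\<^sup>+\<omega>. base_loss \<omega> \<partial>Q) \<le> R"
    and R: "\<And>I. I \<in> S \<Longrightarrow> (\<integral>\<^sup>+\<omega>. loss I \<omega> * ennreal (lik I \<omega>) \<partial>Q) \<le> R"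
  shows "ennreal \<delta> \<le> 2 * R + ennreal (\<delta> * K / 4)"
proof -
  define N where "N = real (card S)"
  have N: "N > 0" using S by (auto simp: N_def card_gt_0_iff)
  define Z where "Z \<omega> = (\<Sum>I\<in>S. lik I \<omega>) / N" for \<omega>
  have [measurable]: "Z \<in> borel_measurable Q" unfolding Z_def by measurable
  have Z0: "0 \<le> Z \<omega>" if "\<omega> \<in> space Q" for \<omega>
    unfolding Z_def using N nonneg that by (intro divide_nonneg_pos sum_nonneg) auto
  have card: "(of_nat (card S) :: ennreal) = ennreal N"
    by (simp add: N_def ennreal_of_nat_eq_real_of_nat)
  have Zlin: "(\<Sum>I\<in>S. ennreal a * ennreal (lik I \<omega>)) = ennreal (a * N * Z \<omega>)"
    if "\<omega> \<in> space Q" "0 \<le> a" for \<omega> a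
  proof -
    have "(\<Sum>I\<in>S. ennreal a * ennreal (lik I \<omega>)) = (\<Sum>I\<in>S. ennreal (a * lik I \<omega>))"
      using that nonneg by (simp add: ennreal_mult)
    also have "\<dots> = ennreal (\<Sum>I\<in>S. a * lik I \<omega>)"
      using that nonneg by (intro sum_ennreal) auto
    also have "(\<Sum>I\<in>S. a * lik I \<omega>) = a * N * Z \<omega>"
      using N by (simp add: Z_def sum_distrib_left[symmetric])
    finally show ?thesis .
  qed
  \<comment> \<open>The bound holds pointwise and is only integrated afterwards. If the base loss is
    at least \<delta>, it absorbs \<delta> through \<open>Z \<le> 1 + Z^2 / 4\<close>. Otherwise,
    with base loss \<open>l\<close>, the product \<delta>\<open>* Z\<close> splits into
    \<open>l * Z\<close>, treated by the same inequality, and \<open>(\<delta> - l) * Z\<close>,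
    paid for by the other losses, each at least \<open>\<delta> - l\<close>. The factor
    \<open>N\<close> avoids a division of extended numbers.\<close>
  have key: "ennreal (\<delta> * N * Z \<omega>) \<le> ennreal N * base_loss \<omega> + (\<Sum>I\<in>S. loss I \<omega> * ennreal (lik I \<omega>))
      + ennreal (\<delta> * N / 4 * (Z \<omega>)\<^sup>2)" if w: "\<omega> \<in> space Q" for \<omega>
  proof (cases "ennreal \<delta> \<le> base_loss \<omega>")
    case True
    have "0 \<le> (Z \<omega> / 2 - 1)\<^sup>2" by simp
    then have "Z \<omega> \<le> 1 + (Z \<omega>)\<^sup>2 / 4" by (simp add: power2_eq_square field_simps)
    from mult_left_mono[OF this, of "\<delta> * N"] have "\<delta> * N * Z \<omega> \<le> N * \<delta> + \<delta> * N / 4 * (Z \<omega>)\<^sup>2"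
      using \<delta> N by (simp add: field_simps)
    then have "ennreal (\<delta> * N * Z \<omega>) \<le> ennreal (N * \<delta> + \<delta> * N / 4 * (Z \<omega>)\<^sup>2)" by (rule ennreal_leI)
    also have "\<dots> = ennreal N * ennreal \<delta> + ennreal (\<delta> * N / 4 * (Z \<omega>)\<^sup>2)"
      using \<delta> N by (simp add: ennreal_mult)
    also have "\<dots> \<le> ennreal N * base_loss \<omega> + (\<Sum>I\<in>S. loss I \<omega> * ennreal (lik I \<omega>))
        + ennreal (\<delta> * N / 4 * (Z \<omega>)\<^sup>2)"
      using mult_left_mono[OF True, of "ennreal N"] by (intro add_mono) (auto intro: add_increasing2)
    finally show ?thesis .
  next
    case False
    then obtain l where l: "base_loss \<omega> = ennreal l" "0 \<le> l" "l < \<delta>"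
      by (cases "base_loss \<omega>") (auto simp: not_le ennreal_less_iff)
    have ge: "ennreal (\<delta> - l) \<le> loss I \<omega>" if "I \<in> S" for I
      using sep[OF that w] l by (cases "loss I \<omega>") (auto simp flip: ennreal_plus)
    have "0 \<le> (Z \<omega> / 2 - 1)\<^sup>2" by simp
    then have "Z \<omega> \<le> 1 + (Z \<omega>)\<^sup>2 / 4" by (simp add: power2_eq_square field_simps)
    then have "l * Z \<omega> \<le> l * (1 + (Z \<omega>)\<^sup>2 / 4)" using l by (intro mult_left_mono)
    also have "\<dots> \<le> l + \<delta> * ((Z \<omega>)\<^sup>2 / 4)" using l by (simp add: distrib_left mult_right_mono)
    finally have "N * (l * Z \<omega>) \<le> N * (l + \<delta> * ((Z \<omega>)\<^sup>2 / 4))" using N by (intro mult_left_mono) auto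
    then have "\<delta> * N * Z \<omega> \<le> N * l + (\<delta> - l) * N * Z \<omega> + \<delta> * N / 4 * (Z \<omega>)\<^sup>2"
      by (simp add: algebra_simps)
    then have "ennreal (\<delta> * N * Z \<omega>) \<le> ennreal (N * l + (\<delta> - l) * N * Z \<omega> + \<delta> * N / 4 * (Z \<omega>)\<^sup>2)"
      by (rule ennreal_leI)
    also have "\<dots> = ennreal N * base_loss \<omega> + ennreal ((\<delta> - l) * N * Z \<omega>) + ennreal (\<delta> * N / 4 * (Z \<omega>)\<^sup>2)"
      using \<delta> N l Z0[OF w] by (simp add: ennreal_mult)
    also have "ennreal ((\<delta> - l) * N * Z \<omega>) = (\<Sum>I\<in>S. ennreal (\<delta> - l) * ennreal (lik I \<omega>))"
      using l w by (simp add: Zlin)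
    also have "\<dots> \<le> (\<Sum>I\<in>S. loss I \<omega> * ennreal (lik I \<omega>))"
      using ge by (intro sum_mono mult_right_mono) auto
    finally show ?thesis by (simp add: add_mono)
  qed
  have "ennreal (\<delta> * N) = (\<Sum>I\<in>S. ennreal \<delta> * (\<integral>\<^sup>+\<omega>. ennreal (lik I \<omega>) \<partial>Q))"
    using \<delta> N by (simp add: lik1 card ennreal_mult mult.commute)
  also have "\<dots> = (\<integral>\<^sup>+\<omega>. (\<Sum>I\<in>S. ennreal \<delta> * ennreal (lik I \<omega>)) \<partial>Q)"
    by (subst nn_integral_sum) (auto simp: nn_integral_cmult)
  also have "\<dots> = (\<integral>\<^sup>+\<omega>. ennreal (\<delta> * N * Z \<omega>) \<partial>Q)"
    using \<delta> by (intro nn_integral_cong) (simp add: Zlin)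
  also have "\<dots> \<le> (\<integral>\<^sup>+\<omega>. ennreal N * base_loss \<omega> + (\<Sum>I\<in>S. loss I \<omega> * ennreal (lik I \<omega>))
      + ennreal (\<delta> * N / 4 * (Z \<omega>)\<^sup>2) \<partial>Q)"
    by (intro nn_integral_mono key)
  also have "\<dots> = ennreal N * (\<integral>\<^sup>+\<omega>. base_loss \<omega> \<partial>Q)
      + (\<Sum>I\<in>S. \<integral>\<^sup>+\<omega>. loss I \<omega> * ennreal (lik I \<omega>) \<partial>Q)
      + (\<integral>\<^sup>+\<omega>. ennreal (\<delta> * N / 4 * (Z \<omega>)\<^sup>2) \<partial>Q)"
    by (simp add: nn_integral_add nn_integral_sum nn_integral_cmult)
  also have "\<dots> \<le> ennreal N * R + (\<Sum>I\<in>S. R) + ennreal (N * (\<delta> * K / 4))"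
  proof (intro add_mono mult_left_mono R0 sum_mono R)
    have "(\<integral>\<^sup>+\<omega>. ennreal (\<delta> * N / 4 * (Z \<omega>)\<^sup>2) \<partial>Q)
        = (\<integral>\<^sup>+\<omega>. ennreal (\<delta> / (4 * N)) * (\<Sum>I\<in>S. \<Sum>J\<in>S. ennreal (lik I \<omega> * lik J \<omega>)) \<partial>Q)"
    proof (rule nn_integral_cong)
      fix \<omega> assume w: "\<omega> \<in> space Q"
      \<comment> \<open>Expanding the square exposes the pairwise correlations that the hypothesis
        \<open>K\<close> controls.\<close>
      have Z2: "\<delta> * N / 4 * (Z \<omega>)\<^sup>2 = \<delta> / (4 * N) * (\<Sum>I\<in>S. \<Sum>J\<in>S. lik I \<omega> * lik J \<omega>)"
        using N by (simp add: Z_def power2_eq_square sum_product)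
      have sums: "(\<Sum>I\<in>S. \<Sum>J\<in>S. ennreal (lik I \<omega> * lik J \<omega>))
          = ennreal (\<Sum>I\<in>S. \<Sum>J\<in>S. lik I \<omega> * lik J \<omega>)"
        using nonneg w by (simp add: sum_ennreal sum_nonneg)
      show "ennreal (\<delta> * N / 4 * (Z \<omega>)\<^sup>2)
          = ennreal (\<delta> / (4 * N)) * (\<Sum>I\<in>S. \<Sum>J\<in>S. ennreal (lik I \<omega> * lik J \<omega>))"
        unfolding Z2 sums using \<delta> N nonneg w by (intro ennreal_mult) (auto intro!: sum_nonneg)
    qed
    also have "\<dots> = ennreal (\<delta> / (4 * N)) * (\<Sum>I\<in>S. \<Sum>J\<in>S. \<integral>\<^sup>+\<omega>. ennreal (lik I \<omega> * lik J \<omega>) \<partial>Q)"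
      by (simp add: nn_integral_cmult nn_integral_sum)
    also have "\<dots> \<le> ennreal (\<delta> / (4 * N)) * ennreal (K * (card S)\<^sup>2)"
      by (intro mult_left_mono K) auto
    also have "\<dots> = ennreal (N * (\<delta> * K / 4))"
      using \<delta> N K(2) by (simp add: N_def[symmetric] power2_eq_square flip: ennreal_mult)
    finally show "(\<integral>\<^sup>+\<omega>. ennreal (\<delta> * N / 4 * (Z \<omega>)\<^sup>2) \<partial>Q) \<le> ennreal (N * (\<delta> * K / 4))" .
  qed auto
  also have "\<dots> = ennreal N * (2 * R + ennreal (\<delta> * K / 4))"
    using N \<delta> K(2) by (subst ennreal_mult) (auto simp: card distrib_left mult_2)
  finally have *: "ennreal N * ennreal \<delta> \<le> ennreal N * (2 * R + ennreal (\<delta> * K / 4))"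
    using N \<delta> by (simp add: ennreal_mult mult.commute)
  show ?thesis
    using * N by (subst (asm) ennreal_mult_le_mult_iff) auto
qed

text \<open>The balance conditions say that each factor has mean one, so all first-order terms
  cancel. Since \<open>W\<close> is disjoint from \<open>I\<close> and \<open>J\<close>, the only
  second-order terms left are the overlap of \<open>I\<close> and \<open>J\<close> and the common
  compensation on \<open>W\<close>.\<close>

lemma (in prob_space) expectation_perturbation_product:
  assumes [measurable]: "I \<in> events" "J \<in> events" "W \<in> events"
    and disj: "I \<inter> W = {}" "J \<inter> W = {}"
    and bal: "a * prob I = b * prob W" "a * prob J = c * prob W"
  shows "(\<integral>x. (1 + a * indicator I x - b * indicator W x)
        * (1 + a * indicator J x - c * indicator W x) \<partial>M)
      = 1 + a\<^sup>2 * prob (I \<inter> J) + b * c * prob W"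
proof -
  have int: "has_bochner_integral M (\<lambda>x. k * indicator A x) (k * prob A)" if "A \<in> events" for k :: real and A
    using that by (intro has_bochner_integral_mult_right has_bochner_integral_real_indicator)
      (auto simp: less_top[symmetric])
  have one: "has_bochner_integral M (\<lambda>x. 1::real) 1"
    by (simp add: has_bochner_integral_iff prob_space)
  have "(\<integral>x. (1 + a * indicator I x - b * indicator W x)
        * (1 + a * indicator J x - c * indicator W x) \<partial>M)
      = (\<integral>x. 1 + a * indicator I x + a * indicator J x + a\<^sup>2 * indicator (I \<inter> J) x
          - b * indicator W x - c * indicator W x + b * c * indicator W x \<partial>M)"
    using disj by (intro Bochner_Integration.integral_cong)
      (auto simp: indicator_def power2_eq_square algebra_simps)
  also have "\<dots> = 1 + a * prob I + a * prob J + a\<^sup>2 * prob (I \<inter> J) - b * prob W - c * prob W + b * c * prob W"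
    by (intro has_bochner_integral_integral_eq has_bochner_integral_add has_bochner_integral_diff int one) auto
  finally show ?thesis using bal by simp
qed

section \<open>The family of perturbed block densities\<close>

text \<open>The condition on \<open>L\<close> says that the height \<open>\<theta> * L\<close> on
  all blocks of finite measure would give mass at least one. Hence the blocks outside
  \<open>S\<close> can carry the mass that \<open>S\<close> leaves over without exceeding this
  height. Passing to a subfamily of finite measure makes a constant positive height on it
  possible.\<close>

lemma block_design:
  fixes M :: "'a measure" and L \<theta> :: real
  assumes \<I>: "countable \<I>" "partition_on (space M) \<I>" "\<I> \<subseteq> sets M"
    and pos: "L > 0" "0 < \<theta>" "\<theta> < 1"
    and L: "1 / (ennreal \<theta> * emeasure M (finite_part M \<I>)) \<le> ennreal L"
    and S: "finite S" "S \<subseteq> \<I>" "\<And>I. I \<in> S \<Longrightarrow> emeasure M I < \<infinity>"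
    and mass: "L * (\<Sum>I\<in>S. measure M I) \<le> 1"
  obtains \<U> where "\<U> \<subseteq> \<I> - S" "emeasure M (\<Union>\<U>) < \<infinity>"
    "1 - \<theta> * L * (\<Sum>I\<in>S. measure M I) \<le> \<theta> * L * measure M (\<Union>\<U>)"
proof -
  define s where "s = (\<Sum>I\<in>S. measure M I)"
  define r where "r = 1 - \<theta> * L * s"
  define \<T> where "\<T> = {I \<in> \<I>. emeasure M I < \<infinity>} - S"
  have s0: "0 \<le> s" unfolding s_def by (intro sum_nonneg) auto
  have disj: "disjoint \<I>" using \<I>(2) by (auto simp: partition_on_def)
  have disjT: "disjoint \<T>" and disjS: "disjoint S"
    using disj S(2) by (auto simp: \<T>_def disjoint_def subset_iff)
  have cT: "countable \<T>" "\<T> \<subseteq> sets M" using \<I> by (auto simp: \<T>_def)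
  have SM: "S \<subseteq> sets M" using S \<I> by auto
  have eS: "emeasure M (\<Union>S) = ennreal s"
  proof -
    have "emeasure M (\<Union>S) = (\<Sum>I\<in>S. emeasure M I)"
      using emeasure_Union_disjoint[of S M] S(1) SM disjS by (simp add: countable_finite)
    also have "\<dots> = (\<Sum>I\<in>S. ennreal (measure M I))"
      using S(3) by (intro sum.cong refl emeasure_eq_ennreal_measure) (auto simp: less_top)
    finally show ?thesis by (simp add: s_def)
  qed
  have fp: "finite_part M \<I> = \<Union>S \<union> \<Union>\<T>"
    using S by (auto simp: finite_part_def \<T>_def)
  have "\<Union>S \<inter> \<Union>\<T> = {}"
  proof -
    have "I \<inter> J = {}" if "I \<in> S" "J \<in> \<T>" for I J
      by (rule disjointD[OF disj]) (use that S(2) in \<open>auto simp: \<T>_def\<close>)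
    then show ?thesis by blast
  qed
  moreover have "\<Union>S \<in> sets M" "\<Union>\<T> \<in> sets M"
    using S(1) SM cT by (auto intro!: sets.countable_Union countable_finite)
  ultimately have efp: "emeasure M (finite_part M \<I>) = ennreal s + emeasure M (\<Union>\<T>)"
    unfolding fp eS[symmetric] by (simp add: plus_emeasure)
  have "ennreal (r / (\<theta> * L)) \<le> emeasure M (\<Union>\<T>)"
  proof (cases "emeasure M (\<Union>\<T>)")
    case (real t)
    then have fps: "emeasure M (finite_part M \<I>) = ennreal (s + t)" using efp s0 by simp
    \<comment> \<open>A total measure of zero would turn the lower bound on \<open>L\<close> into
      \<open>1 / 0\<close>, which is infinite for extended numbers.\<close>
    have "s + t \<noteq> 0"
    proof
      assume "s + t = 0"
      then have "(top::ennreal) \<le> ennreal L" using L fps by simp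
      then show False by (simp add: top_unique)
    qed
    then have st: "s + t > 0" using s0 real by simp
    have "ennreal (1 / (\<theta> * (s + t))) \<le> ennreal L"
      using L st pos unfolding fps by (simp add: divide_ennreal flip: ennreal_mult ennreal_1)
    then have "1 \<le> L * (\<theta> * (s + t))" using st pos by (simp add: pos_divide_le_eq)
    then have "r / (\<theta> * L) \<le> t" using pos by (simp add: r_def field_simps)
    then show ?thesis using real by (simp add: ennreal_leI)
  qed simp
  then obtain \<U> where \<U>: "\<U> \<subseteq> \<T>" "ennreal (r / (\<theta> * L)) \<le> emeasure M (\<Union>\<U>)" "emeasure M (\<Union>\<U>) < \<infinity>"
    using subfamily_finite_mass[OF cT disjT, of "r / (\<theta> * L)"] by (auto simp: \<T>_def)
  have "ennreal (r / (\<theta> * L)) \<le> ennreal (measure M (\<Union>\<U>))"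
    using \<U>(2,3) by (simp add: emeasure_eq_ennreal_measure)
  then have "r / (\<theta> * L) \<le> measure M (\<Union>\<U>)" by simp
  then have "r \<le> \<theta> * L * measure M (\<Union>\<U>)" using pos by (simp add: pos_divide_le_eq mult.commute)
  moreover have "\<U> \<subseteq> \<I> - S" using \<U>(1) by (auto simp: \<T>_def)
  ultimately show ?thesis using that \<U>(3) by (auto simp: r_def s_def)
qed

text \<open>Everything follows from \<open>(1 + y) ^ n \<le> exp (n * y)\<close>. Off the diagonal,
  \<open>ln (1 + N) \<le> N\<close> and \<open>N * (L * h) \<le> 1\<close> bound the exponent by
  \<open>1 / 4\<close>. On the diagonal, \<open>L * h \<le> 1\<close> makes the compensation term
  comparable to the overlap term, and the exponent stays below \<open>ln (1 + N)\<close>.\<close>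

lemma correlation_bounds:
  fixes n N :: nat and L \<theta> h \<delta> m m' r :: real
  assumes "0 < L" "0 < \<theta>" "\<theta> < 1" "0 < h" "1 \<le> N" "N * (L * h) \<le> 1"
    and m: "0 \<le> m" "m \<le> h" "0 \<le> m'" "m' \<le> h" and r: "1 - \<theta> \<le> r"
    and \<delta>: "n * \<delta>\<^sup>2 * h \<le> L * \<theta> * (1 - \<theta>) * ln (1 + N) / 4"
  shows "(1 + \<delta>\<^sup>2 * m * m' / r) ^ n \<le> 3 / 2"
    and "(1 + \<delta>\<^sup>2 * m / (\<theta> * L) + \<delta>\<^sup>2 * m * m / r) ^ n \<le> 1 + N"
proof -
  have Lh: "L * h \<le> 1"
  proof -
    have "1 * (L * h) \<le> N * (L * h)" using assms by (intro mult_right_mono) auto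
    then show ?thesis using assms by linarith
  qed
  have r0: "0 < r" using assms by linarith
  have nd: "0 \<le> n * \<delta>\<^sup>2" by simp
  have lnN: "ln (1 + real N) \<le> N" by (rule ln_add_one_self_le_self) auto
  have mm: "n * (\<delta>\<^sup>2 * x * y / r) \<le> n * \<delta>\<^sup>2 * h * (h / (1 - \<theta>))"
    if "0 \<le> x" "x \<le> h" "0 \<le> y" "y \<le> h" for x y
  proof -
    have "x * y / r \<le> h * h / (1 - \<theta>)"
      using that assms by (intro frac_le mult_mono) auto
    from mult_left_mono[OF this nd] show ?thesis by (simp add: field_simps)
  qed
  have pow: "(1 + y) ^ n \<le> exp (n * y)" if "0 \<le> y" for y :: real
  proof -
    have "(1 + y) ^ n \<le> exp y ^ n" using that by (intro power_mono) auto
    then show ?thesis by (simp add: exp_of_nat_mult)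
  qed
  show "(1 + \<delta>\<^sup>2 * m * m' / r) ^ n \<le> 3 / 2"
  proof -
    have "n * (\<delta>\<^sup>2 * m * m' / r) \<le> n * \<delta>\<^sup>2 * h * (h / (1 - \<theta>))" by (rule mm) fact+
    also have "\<dots> \<le> L * \<theta> * (1 - \<theta>) * ln (1 + N) / 4 * (h / (1 - \<theta>))"
      using assms by (intro mult_right_mono) auto
    also have "\<dots> = \<theta> * (L * h * ln (1 + N)) / 4" using assms by (simp add: field_simps)
    also have "\<dots> \<le> 1 * (L * h * N) / 4"
      using assms lnN by (intro divide_right_mono mult_mono) auto
    also have "\<dots> \<le> 1 / 4" using assms by (simp add: mult_ac)
    finally have le: "n * (\<delta>\<^sup>2 * m * m' / r) \<le> 1 / 4" .
    have "(1 + \<delta>\<^sup>2 * m * m' / r) ^ n \<le> exp (n * (\<delta>\<^sup>2 * m * m' / r))"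
      using m r0 by (intro pow) auto
    also have "\<dots> \<le> exp (1 / 4)" using le by simp
    also have "\<dots> \<le> 1 + 1 / 4 + (1 / 4)\<^sup>2" by (rule exp_bound) auto
    finally show ?thesis by (simp add: power2_eq_square)
  qed
  show "(1 + \<delta>\<^sup>2 * m / (\<theta> * L) + \<delta>\<^sup>2 * m * m / r) ^ n \<le> 1 + N"
  proof -
    let ?y = "\<delta>\<^sup>2 * m / (\<theta> * L) + \<delta>\<^sup>2 * m * m / r"
    have 1: "n * (\<delta>\<^sup>2 * m / (\<theta> * L)) \<le> n * \<delta>\<^sup>2 * h * (1 / (\<theta> * L))"
      using mult_left_mono[OF m(2) nd] assms by (simp add: field_simps)
    have "h \<le> 1 / L" using assms Lh by (simp add: field_simps)
    then have "h / (1 - \<theta>) \<le> 1 / L / (1 - \<theta>)" using assms by (intro divide_right_mono) auto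
    then have "h / (1 - \<theta>) \<le> 1 / (L * (1 - \<theta>))" by simp
    then have 2: "n * \<delta>\<^sup>2 * h * (h / (1 - \<theta>)) \<le> n * \<delta>\<^sup>2 * h * (1 / (L * (1 - \<theta>)))"
      using assms by (intro mult_left_mono) auto
    have "n * ?y \<le> n * \<delta>\<^sup>2 * h * (1 / (\<theta> * L) + 1 / (L * (1 - \<theta>)))"
      using 1 2 mm[OF m(1,2) m(1,2)] unfolding distrib_left by linarith
    \<comment> \<open>This identity is the source of the factor
      \<open>\<theta> * (1 - \<theta>)\<close> in the admissible separation.\<close>
    also have "1 / (\<theta> * L) + 1 / (L * (1 - \<theta>)) = 1 / (L * \<theta> * (1 - \<theta>))"
      using assms by (simp add: field_simps)
    also have "n * \<delta>\<^sup>2 * h * \<dots> \<le> L * \<theta> * (1 - \<theta>) * ln (1 + N) / 4 * (1 / (L * \<theta> * (1 - \<theta>)))"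
      using assms by (intro mult_right_mono) auto
    also have "\<dots> = ln (1 + N) / 4" using assms by (simp add: field_simps)
    also have "\<dots> \<le> ln (1 + N)" by simp
    finally have le: "n * ?y \<le> ln (1 + N)" .
    have "(1 + ?y) ^ n \<le> exp (n * ?y)" using m r0 assms by (intro pow) auto
    also have "\<dots> \<le> exp (ln (1 + N))" using le by (simp only: exp_le_cancel_iff)
    also have "\<dots> = 1 + N" by (subst exp_ln) auto
    finally show ?thesis by (simp add: add_ac)
  qed
qed

lemma prob_space_densityI:
  assumes [measurable]: "f \<in> borel_measurable M" and 1: "(\<integral>\<^sup>+x. f x \<partial>M) = 1"
  shows "prob_space (density M f)"
proof (rule prob_spaceI)
  have "emeasure (density M f) (space M) = (\<integral>\<^sup>+x. f x * indicator (space M) x \<partial>M)"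
    by (rule emeasure_density) auto
  also have "\<dots> = (\<integral>\<^sup>+x. f x \<partial>M)" by (intro nn_integral_cong) simp
  finally show "emeasure (density M f) (space (density M f)) = 1" using 1 by simp
qed

text \<open>Second moment constant \<open>18 / 5\<close> turns the mixture bound into
  \<open>\<delta> \<le> 2 * R + 9 / 10 * \<delta>\<close>, whence the factor \<open>1 / 20\<close>.
  The two upper bounds on \<delta> play different parts: the first keeps the alternatives
  nonnegative and below \<open>L\<close>, the second keeps them statistically close to the null
  density.\<close>

lemma sup_risk_ge_separation:
  fixes M :: "'a measure" and L \<theta> h \<delta> :: real
  assumes \<I>: "countable \<I>" "partition_on (space M) \<I>" "\<I> \<subseteq> sets M"
    and block_pos: "\<And>I. I \<in> \<I> \<Longrightarrow> emeasure M I > 0"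
    and pos: "0 < L" "0 < \<theta>" "\<theta> < 1" "0 < h"
    and L: "1 / (ennreal \<theta> * emeasure M (finite_part M \<I>)) \<le> ennreal L"
    and S: "finite S" "S \<noteq> {}" "S \<subseteq> \<I>" "\<And>I. I \<in> S \<Longrightarrow> emeasure M I \<le> ennreal h"
    and card: "card S * (L * h) \<le> 1"
    and \<delta>: "0 \<le> \<delta>" "\<delta> \<le> (1 - \<theta>) * L"
      "n * \<delta>\<^sup>2 * h \<le> L * \<theta> * (1 - \<theta>) * ln (1 + card S) / 4"
    and q: "q \<in> estimators M n (block_densities M \<I> L)"
  shows "ennreal (\<delta> / 20) \<le> sup_risk M n (block_densities M \<I> L) q"
proof -
  define m where "m I = measure M I" for I
  have m0: "0 \<le> m I" for I by (simp add: m_def)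
  have Sfin: "emeasure M I < \<infinity>" if "I \<in> S" for I
    using S(4)[OF that] by (auto intro: le_less_trans)
  have em: "emeasure M I = ennreal (m I)" if "I \<in> S" for I
    unfolding m_def using Sfin[OF that] by (intro emeasure_eq_ennreal_measure) auto
  have mh: "m I \<le> h" if "I \<in> S" for I
    using S(4)[OF that] pos m0 by (simp add: em[OF that])
  have N1: "1 \<le> card S" using S by (simp add: Suc_le_eq card_gt_0_iff)
  have Lh: "L * h \<le> 1"
  proof -
    have "1 * (L * h) \<le> card S * (L * h)" using pos N1 by (intro mult_right_mono) auto
    then show ?thesis using card by linarith
  qed
  define s where "s = (\<Sum>I\<in>S. m I)"
  have "s \<le> card S * h" unfolding s_def using mh sum_bounded_above[of S m h] by auto
  then have "L * s \<le> L * (card S * h)" using pos by (intro mult_left_mono) auto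
  then have Ls: "L * s \<le> 1" using card by (simp add: mult_ac)
  obtain \<U> where \<U>: "\<U> \<subseteq> \<I> - S" "emeasure M (\<Union>\<U>) < \<infinity>"
    and Uw: "1 - \<theta> * L * s \<le> \<theta> * L * measure M (\<Union>\<U>)"
    using block_design[OF \<I> pos(1-3) L S(1,3) Sfin] Ls unfolding s_def m_def by metis
  define W where "W = \<Union>\<U>"
  define w where "w = measure M W"
  define r where "r = 1 - \<theta> * L * s"
  define \<kappa> where "\<kappa> = r / w"
  have "\<theta> * (L * s) \<le> \<theta> * 1" using Ls pos by (intro mult_left_mono) auto
  then have r1: "1 - \<theta> \<le> r" by (simp add: r_def mult_ac)
  then have r: "1 - \<theta> \<le> r" "0 < r" using pos by linarith+
  have rw: "r \<le> \<theta> * L * w" using Uw by (simp add: r_def w_def W_def)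
  then have "0 < \<theta> * L * w" using r by linarith
  then have w: "0 < w" using pos by (intro zero_less_mult_pos[of "\<theta> * L" w]) auto
  \<comment> \<open>Spreading the mass \<open>r\<close> evenly over \<open>W\<close> gives the
    height \<kappa>; \<open>block_design\<close> chose \<open>W\<close> large enough for this height
    to stay below \<open>\<theta> * L\<close>.\<close>
  have \<kappa>: "0 < \<kappa>" "\<kappa> \<le> \<theta> * L" "\<kappa> * w = r" using w r rw by (simp_all add: \<kappa>_def pos_divide_le_eq)
  define A where "A = \<Union>S"

  have disj: "I \<inter> J = {}" if "I \<in> \<I>" "J \<in> \<I>" "I \<noteq> J" for I J
    using \<I>(2) that by (auto simp: partition_on_def disjoint_def)
  have SM[measurable]: "I \<in> sets M" if "I \<in> S" for I using S(3) \<I>(3) that by auto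
  have "countable \<U>" using \<U>(1) \<I>(1) by (auto intro: countable_subset)
  then have [measurable]: "W \<in> sets M" unfolding W_def using \<U>(1) \<I>(3) by (intro sets.countable_Union) auto
  have [measurable]: "A \<in> sets M" unfolding A_def using S(1) SM by (intro sets.finite_Union) auto
  have eW: "emeasure M W = ennreal w"
    unfolding w_def using \<U>(2) by (intro emeasure_eq_ennreal_measure) (auto simp: W_def)
  have eA: "emeasure M A = ennreal s"
  proof -
    have "emeasure M A = (\<Sum>I\<in>S. emeasure M I)"
      unfolding A_def using S(1,3) SM disj
      by (subst emeasure_Union_disjoint) (auto simp: countable_finite disjoint_def subset_iff)
    also have "\<dots> = ennreal s" unfolding s_def using m0 by (simp add: em)
    finally show ?thesis .
  qed
  have s0: "0 \<le> s" unfolding s_def using m0 by (intro sum_nonneg) auto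
  have indW: "indicator W x = (if I \<in> \<U> then 1 else 0 :: real)" if "I \<in> \<I>" "x \<in> I" for I x
    using disj[OF that(1)] \<U>(1) that by (fastforce simp: W_def indicator_def)
  have indA: "indicator A x = (if I \<in> S then 1 else 0 :: real)" if "I \<in> \<I>" "x \<in> I" for I x
    using disj[OF that(1)] S(3) that by (fastforce simp: A_def indicator_def)
  have indS: "indicator J x = (if I = J then 1 else 0 :: real)" if "I \<in> \<I>" "x \<in> I" "J \<in> S" for I J x
    using disj[OF that(1), of J] S(3) that by (auto simp: indicator_def)
  have SW: "I \<inter> W = {}" if "I \<in> S" for I
    using disj[of I] \<U>(1) S(3) that by (fastforce simp: W_def)

  \<comment> \<open>The perturbed densities and their membership in the class\<close>
  define p where "p d I x = \<theta> * L * indicator A x + d * indicator I x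
      + \<kappa> * (1 - d * m I / r) * indicator W x" for d I x
  have p_meas[measurable]: "p d I \<in> borel_measurable M" if "I \<in> S" for d I
    unfolding p_def[abs_def] using SM[OF that] by measurable
  \<comment> \<open>The mass taken back from \<open>W\<close> never exceeds the mass present there,
    so the density stays nonnegative on \<open>W\<close>.\<close>
  have loss_le: "d * m I \<le> r" if "I \<in> S" "0 \<le> d" "d \<le> (1 - \<theta>) * L" for d I
  proof -
    have "d * m I \<le> ((1 - \<theta>) * L) * h" using that mh m0 pos by (intro mult_mono) auto
    also have "\<dots> = (1 - \<theta>) * (L * h)" by simp
    also have "\<dots> \<le> (1 - \<theta>) * 1" using Lh pos by (intro mult_left_mono) auto
    also have "\<dots> \<le> r" using r by simp
    finally show ?thesis .
  qed
  have p_mem: "p d I \<in> block_densities M \<I> L" and p_int: "(\<integral>\<^sup>+x. ennreal (p d I x) \<partial>M) = 1"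
    and p_nonneg: "\<And>x. 0 \<le> p d I x"
    if I: "I \<in> S" and d: "0 \<le> d" "d \<le> (1 - \<theta>) * L" for d I
  proof -
    have b: "0 \<le> d * m I / r" "d * m I / r \<le> 1"
      using loss_le[OF that] d m0 r by simp_all
    show nonneg: "0 \<le> p d I x" for x
      unfolding p_def using pos d \<kappa> b by (intro add_nonneg_nonneg mult_nonneg_nonneg) auto
    have ennreal_ind: "ennreal (u * indicator A x + v * indicator I x + z * indicator W x)
        = ennreal u * indicator A x + ennreal v * indicator I x + ennreal z * indicator W x"
      if "0 \<le> u" "0 \<le> v" "0 \<le> z" for u v z x
      using that by (auto simp: indicator_def)
    have "(\<integral>\<^sup>+x. ennreal (p d I x) \<partial>M)
        = (\<integral>\<^sup>+x. ennreal (\<theta> * L) * indicator A x + ennreal d * indicator I x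
            + ennreal (\<kappa> * (1 - d * m I / r)) * indicator W x \<partial>M)"
      unfolding p_def using pos d \<kappa> b by (intro nn_integral_cong ennreal_ind) auto
    also have "\<dots> = ennreal (\<theta> * L) * ennreal s + ennreal d * ennreal (m I)
        + ennreal (\<kappa> * (1 - d * m I / r)) * ennreal w"
      using SM[OF I] by (simp add: nn_integral_add nn_integral_cmult_indicator eA eW em[OF I])
    also have "\<dots> = ennreal (\<theta> * L * s + d * m I + \<kappa> * (1 - d * m I / r) * w)"
      using pos d \<kappa> b w s0 m0 by (simp flip: ennreal_mult ennreal_plus)
    also have "\<theta> * L * s + d * m I + \<kappa> * (1 - d * m I / r) * w = 1"
    proof -
      have "\<kappa> * (1 - d * m I / r) * w = \<kappa> * w * (1 - d * m I / r)" by simp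
      also have "\<dots> = r - d * m I" unfolding \<kappa>(3) using r by (simp add: field_simps)
      finally show ?thesis by (simp add: r_def)
    qed
    finally show int: "(\<integral>\<^sup>+x. ennreal (p d I x) \<partial>M) = 1" by simp
    have "\<kappa> * (1 - d * m I / r) \<le> \<kappa> * 1" using b \<kappa> by (intro mult_left_mono) auto
    \<comment> \<open>The margin \<open>(1 - \<theta>) * L\<close> between the null height and the
      cap \<open>L\<close> is exactly what limits the perturbation.\<close>
    moreover have \<theta>L: "\<theta> * L \<le> L" "\<theta> * L + d \<le> L" "0 \<le> \<theta> * L"
      using pos d by (auto simp: algebra_simps)
    ultimately have "\<kappa> * (1 - d * m I / r) \<le> L" using \<kappa>(2) by linarith
    moreover have "0 \<le> \<kappa> * (1 - d * m I / r)"
      using b \<kappa> by (intro mult_nonneg_nonneg) auto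
    ultimately have \<kappa>L: "\<kappa> * (1 - d * m I / r) \<in> {0..L}" by simp
    show "p d I \<in> block_densities M \<I> L"
    proof (rule block_densitiesI[OF \<I> _ _ _ int])
      show "(\<lambda>J. if J \<in> S then \<theta> * L + (if J = I then d else 0)
          else if J \<in> \<U> then \<kappa> * (1 - d * m I / r) else 0) \<in> \<I> \<rightarrow> {0..L}"
        using \<kappa>L \<theta>L d pos by auto
      show "p d I x = (if J \<in> S then \<theta> * L + (if J = I then d else 0)
          else if J \<in> \<U> then \<kappa> * (1 - d * m I / r) else 0)" if J: "J \<in> \<I>" "x \<in> J" for J x
        unfolding p_def indA[OF J] indW[OF J] indS[OF J I] using I \<U>(1) by auto
      show "p d I x = 0" if "x \<notin> space M" for x
      proof -
        have "x \<notin> A" "x \<notin> W" "x \<notin> I"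
          using that sets.sets_into_space[OF SM[OF I]] sets.sets_into_space[OF \<open>A \<in> sets M\<close>]
            sets.sets_into_space[OF \<open>W \<in> sets M\<close>] by auto
        then show ?thesis by (simp add: p_def)
      qed
    qed
  qed

  obtain I0 where I0: "I0 \<in> S" using S(2) by auto
  \<comment> \<open>For \<open>d = 0\<close> the choice of the block has no influence, so any
    element of \<open>S\<close> serves, and the facts proved for \<open>p\<close> carry over to the
    null density.\<close>
  define p0 where "p0 = p 0 I0"
  have p0_eq: "p0 x = \<theta> * L * indicator A x + \<kappa> * indicator W x" for x by (simp add: p0_def p_def)
  have le0: "0 \<le> (1 - \<theta>) * L" using pos by simp
  have [measurable]: "p0 \<in> borel_measurable M" unfolding p0_def using I0 by measurable
  have p0: "p0 \<in> block_densities M \<I> L" "(\<integral>\<^sup>+x. ennreal (p0 x) \<partial>M) = 1" "\<And>x. 0 \<le> p0 x"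
    unfolding p0_def using p_mem p_int p_nonneg I0 le0 by auto

  \<comment> \<open>The null law\<close>
  define Q where "Q = density M (\<lambda>x. ennreal (p0 x))"
  have [measurable_cong]: "sets Q = sets M" by (simp add: Q_def)
  interpret Q: prob_space Q
    unfolding Q_def by (rule prob_space_densityI) (use p0 in auto)
  have QW: "Q.prob W = r"
  proof -
    have "emeasure Q W = (\<integral>\<^sup>+x. ennreal (p0 x) * indicator W x \<partial>M)"
      by (simp add: Q_def emeasure_density)
    also have "\<dots> = (\<integral>\<^sup>+x. ennreal \<kappa> * indicator W x \<partial>M)"
      using SW by (intro nn_integral_cong) (auto simp: p0_eq A_def indicator_def)
    also have "\<dots> = ennreal r" using \<kappa> w by (simp add: nn_integral_cmult_indicator eW flip: ennreal_mult)
    finally show ?thesis using r by (simp add: Q.emeasure_eq_measure)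
  qed
  have QI: "Q.prob I = \<theta> * L * m I" if I: "I \<in> S" for I
  proof -
    have [measurable]: "I \<in> sets M" using SM[OF I] .
    have "emeasure Q I = (\<integral>\<^sup>+x. ennreal (p0 x) * indicator I x \<partial>M)"
      by (simp add: Q_def emeasure_density)
    also have "\<dots> = (\<integral>\<^sup>+x. ennreal (\<theta> * L) * indicator I x \<partial>M)"
      using SW[OF I] I by (intro nn_integral_cong) (auto simp: p0_eq A_def indicator_def)
    also have "\<dots> = ennreal (\<theta> * L * m I)"
      using pos m0 by (simp add: nn_integral_cmult_indicator em[OF I] flip: ennreal_mult)
    finally show ?thesis using pos m0 by (simp add: Q.emeasure_eq_measure)
  qed

  \<comment> \<open>Likelihood ratios and their correlations\<close>
  define a where "a = \<delta> / (\<theta> * L)"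
  define b where "b I = \<delta> * m I / r" for I
  define g where "g I x = 1 + a * indicator I x - b I * indicator W x" for I x
  have a0: "0 \<le> a" using pos \<delta> by (simp add: a_def)
  have b01: "0 \<le> b I" "b I \<le> 1" if "I \<in> S" for I
    using loss_le[OF that \<delta>(1,2)] \<delta> m0 r by (simp_all add: b_def)
  have g0: "0 \<le> g I x" if "I \<in> S" for I x
    using b01[OF that] a0 by (auto simp: g_def indicator_def)
  have [measurable]: "g I \<in> borel_measurable M" if "I \<in> S" for I
    unfolding g_def[abs_def] using SM[OF that] by measurable
  \<comment> \<open>The factorisation holds at every point, because the alternative vanishes
    wherever the null density does. Here \<open>a\<close> is the relative gain on \<open>I\<close>
    and \<open>b I\<close> the relative loss on \<open>W\<close>.\<close>
  have p_fac: "p \<delta> I x = p0 x * g I x" if "I \<in> S" for I x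
    using SW[OF that] SW that pos
    by (auto simp: p0_eq p_def g_def a_def b_def A_def indicator_def field_simps)
  \<comment> \<open>Both sides equal \<open>\<delta> * m I\<close>, the mass moved from
    \<open>W\<close> to \<open>I\<close>.\<close>
  have bal: "a * Q.prob I = b I * Q.prob W" if "I \<in> S" for I
    using pos r by (simp add: QI[OF that] QW a_def b_def)

  have dens: "density M (\<lambda>x. ennreal (p \<delta> I x)) = density Q (\<lambda>x. ennreal (g I x))" if "I \<in> S" for I
    using that p0(3) g0[OF that] unfolding Q_def
    by (subst density_density_eq) (auto simp: p_fac[OF that] ennreal_mult)
  define PQ where "PQ = PiM {..<n} (\<lambda>_. Q)"
  have [measurable_cong]: "sets PQ = sets (PiM {..<n} (\<lambda>_. M))"
    unfolding PQ_def by (rule sets_PiM_cong) (simp_all add: Q_def)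
  have spPQ: "space PQ = space (PiM {..<n} (\<lambda>_. M))" by (rule sets_eq_imp_space_eq) fact
  define lik where "lik I \<omega> = (\<Prod>i<n. g I (\<omega> i))" for I \<omega>
  have lik_meas[measurable]: "lik I \<in> borel_measurable PQ" if "I \<in> S" for I
    unfolding lik_def[abs_def] using that by measurable
  have law0: "sample_law M n p0 = PQ" by (simp add: sample_law_def PQ_def Q_def)
  have law: "sample_law M n (p \<delta> I) = density PQ (\<lambda>\<omega>. ennreal (lik I \<omega>))" if I: "I \<in> S" for I
  proof -
    have "prob_space (density Q (\<lambda>x. ennreal (g I x)))"
      unfolding dens[OF I, symmetric]
      by (rule prob_space_densityI) (use I p_int[OF I \<delta>(1,2)] in auto)
    then have "sigma_finite_measure (density Q (\<lambda>x. ennreal (g I x)))"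
      by (simp add: prob_space_imp_sigma_finite)
    then have "PiM {..<n} (\<lambda>_. density Q (\<lambda>x. ennreal (g I x)))
        = density PQ (\<lambda>\<omega>. \<Prod>i<n. ennreal (g I (\<omega> i)))"
      unfolding PQ_def using I by (intro PiM_density) (auto intro: Q.sigma_finite_measure_axioms)
    also have "(\<lambda>\<omega>. \<Prod>i<n. ennreal (g I (\<omega> i))) = (\<lambda>\<omega>. ennreal (lik I \<omega>))"
      using g0[OF I] by (simp add: lik_def prod_ennreal)
    finally show ?thesis by (simp add: sample_law_def dens[OF I])
  qed
  have sampling: "(\<integral>\<^sup>+\<omega>. ennreal (\<Prod>i<n. f (\<omega> i)) \<partial>PQ) = ennreal ((\<integral>x. f x \<partial>Q) ^ n)"
    if [measurable]: "f \<in> borel_measurable M" and f: "\<And>x. 0 \<le> f x" "integrable Q f" for f :: "'a \<Rightarrow> real"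
  proof -
    interpret product_sigma_finite "\<lambda>_. Q"
      by (simp add: product_sigma_finite_def Q.sigma_finite_measure_axioms)
    have "(\<integral>\<^sup>+\<omega>. ennreal (\<Prod>i<n. f (\<omega> i)) \<partial>PQ) = (\<integral>\<^sup>+\<omega>. (\<Prod>i<n. ennreal (f (\<omega> i))) \<partial>PQ)"
      using f by (simp add: prod_ennreal)
    also have "\<dots> = (\<Prod>i<n. \<integral>\<^sup>+x. ennreal (f x) \<partial>Q)"
      unfolding PQ_def by (intro product_nn_integral_prod) auto
    also have "\<dots> = ennreal ((\<integral>x. f x \<partial>Q) ^ n)"
      using f by (simp add: nn_integral_eq_integral ennreal_power)
    finally show ?thesis .
  qed
  have int_g: "integrable Q (g I)" "integrable Q (\<lambda>x. g I x * g J x)" if "I \<in> S" "J \<in> S" for I J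
  proof -
    have bd: "\<bar>g I x\<bar> \<le> 1 + a" if "I \<in> S" for I x
      using g0[OF that, of x] b01[OF that] a0 by (auto simp: g_def indicator_def)
    show "integrable Q (g I)"
      using that bd by (intro Q.integrable_const_bound[where B="1 + a"]) auto
    have "\<bar>g I x * g J x\<bar> \<le> (1 + a) * (1 + a)" for x
      unfolding abs_mult using that bd a0 by (intro mult_mono) auto
    then show "integrable Q (\<lambda>x. g I x * g J x)"
      using that by (intro Q.integrable_const_bound[where B="(1 + a) * (1 + a)"]) auto
  qed
  have corr: "(\<integral>\<^sup>+\<omega>. ennreal (lik I \<omega> * lik J \<omega>) \<partial>PQ)
      = ennreal ((1 + a\<^sup>2 * Q.prob (I \<inter> J) + b I * b J * r) ^ n)" if IJ: "I \<in> S" "J \<in> S" for I J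
  proof -
    have "(\<integral>\<^sup>+\<omega>. ennreal (lik I \<omega> * lik J \<omega>) \<partial>PQ) = (\<integral>\<^sup>+\<omega>. ennreal (\<Prod>i<n. g I (\<omega> i) * g J (\<omega> i)) \<partial>PQ)"
      by (simp add: lik_def prod.distrib)
    also have "\<dots> = ennreal ((\<integral>x. g I x * g J x \<partial>Q) ^ n)"
      using IJ g0 int_g by (intro sampling) auto
    also have "(\<integral>x. g I x * g J x \<partial>Q) = 1 + a\<^sup>2 * Q.prob (I \<inter> J) + b I * b J * r"
      unfolding g_def QW[symmetric] using IJ SW bal
      by (intro Q.expectation_perturbation_product) auto
    finally show ?thesis .
  qed
  have lik1: "(\<integral>\<^sup>+\<omega>. ennreal (lik I \<omega>) \<partial>PQ) = 1" if I: "I \<in> S" for I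
  proof -
    have "(\<integral>x. g I x \<partial>Q) = 1"
      \<comment> \<open>With an empty second block and \<open>c = 0\<close> the second factor is
        constantly one, leaving the mean of \<open>g I\<close>.\<close>
      using Q.expectation_perturbation_product[of I "{}" W a "b I" 0] I SW bal by (simp add: g_def)
    then show ?thesis
      using sampling[of "g I"] I g0 int_g by (simp add: lik_def)
  qed
  let ?N = "real (card S)"
  \<comment> \<open>The summand \<open>3 / 2\<close> is kept on the diagonal as well, so that the
    double sum splits into a constant part and a diagonal part.\<close>
  have corr_le: "(\<integral>\<^sup>+\<omega>. ennreal (lik I \<omega> * lik J \<omega>) \<partial>PQ) \<le> ennreal ((if I = J then 1 + ?N else 0) + 3 / 2)"
    if IJ: "I \<in> S" "J \<in> S" for I J
  proof -
    have bb: "b I * b J * r = \<delta>\<^sup>2 * m I * m J / r"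
      using r by (simp add: b_def power2_eq_square field_simps)
    show ?thesis
    proof (cases "I = J")
      case True
      have "a\<^sup>2 * Q.prob (I \<inter> J) = \<delta>\<^sup>2 * m I / (\<theta> * L)"
        using pos True by (simp add: QI[OF IJ(2)] a_def power2_eq_square field_simps)
      then have "(1 + a\<^sup>2 * Q.prob (I \<inter> J) + b I * b J * r) ^ n \<le> 1 + ?N"
        using correlation_bounds(2)[OF pos N1 card m0 mh[OF IJ(1)] m0 mh[OF IJ(2)] r(1) \<delta>(3)] True bb by simp
      then show ?thesis unfolding corr[OF IJ] using True by (intro ennreal_leI) simp
    next
      case False
      then have "I \<inter> J = {}" using disj IJ S(3) by auto
      then have "(1 + a\<^sup>2 * Q.prob (I \<inter> J) + b I * b J * r) ^ n \<le> 3 / 2"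
        using correlation_bounds(1)[OF pos N1 card m0 mh[OF IJ(1)] m0 mh[OF IJ(2)] r(1) \<delta>(3)] bb by simp
      then show ?thesis unfolding corr[OF IJ] using False by (intro ennreal_leI) simp
    qed
  qed
  have K: "(\<Sum>I\<in>S. \<Sum>J\<in>S. \<integral>\<^sup>+\<omega>. ennreal (lik I \<omega> * lik J \<omega>) \<partial>PQ) \<le> ennreal (18 / 5 * ?N\<^sup>2)"
  proof -
    have "(\<Sum>I\<in>S. \<Sum>J\<in>S. \<integral>\<^sup>+\<omega>. ennreal (lik I \<omega> * lik J \<omega>) \<partial>PQ)
        \<le> (\<Sum>I\<in>S. \<Sum>J\<in>S. ennreal ((if I = J then 1 + ?N else 0) + 3 / 2))"
      by (intro sum_mono corr_le)
    also have "\<dots> = ennreal (\<Sum>I\<in>S. \<Sum>J\<in>S. (if I = J then 1 + ?N else 0) + 3 / 2)"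
      by (subst sum_ennreal[symmetric], force intro!: sum_nonneg)
        (intro sum.cong refl sum_ennreal, auto)
    also have "(\<Sum>I\<in>S. \<Sum>J\<in>S. (if I = J then 1 + ?N else 0) + 3 / 2) = ?N * (1 + ?N + ?N * (3 / 2))"
      using S(1) by (simp add: sum.distrib)
    \<comment> \<open>After division by \<open>?N\<close> this reads
      \<open>1 + 5 / 2 * ?N \<le> 18 / 5 * ?N\<close>, which holds from \<open>?N = 1\<close>
      on.\<close>
    also have "\<dots> \<le> 18 / 5 * ?N\<^sup>2"
    proof -
      have "?N * (1 + ?N + ?N * (3 / 2)) \<le> ?N * (18 / 5 * ?N)"
        using N1 by (intro mult_left_mono) auto
      then show ?thesis by (simp add: power2_eq_square mult_ac)
    qed
    finally show ?thesis by (simp add: ennreal_leI)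
  qed

  \<comment> \<open>From the losses of an estimator to the mixture bound\<close>
  define \<P> where "\<P> = block_densities M \<I> L"
  define R where "R = sup_risk M n \<P> q"
  define \<l> where "\<l> f \<omega> = Linf_norm M (\<lambda>x. q \<omega> x - f x)" for f \<omega>
  have q_meas: "q \<omega> \<in> borel_measurable M" if "\<omega> \<in> space PQ" for \<omega>
    using q that by (simp add: estimators_def spPQ)
  have \<l>_meas: "\<l> f \<in> borel_measurable PQ" if "f \<in> \<P>" for f
  proof -
    have "\<l> f \<in> borel_measurable (PiM {..<n} (\<lambda>_. M))"
      using q that by (simp add: estimators_def \<l>_def[abs_def] \<P>_def)
    then show ?thesis by measurable
  qed
  have risk: "(\<integral>\<^sup>+\<omega>. \<l> f \<omega> \<partial>sample_law M n f) \<le> R" if "f \<in> \<P>" for f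
    unfolding R_def sup_risk_def \<l>_def using that by (rule SUP_upper)
  have mem: "p0 \<in> \<P>" "\<And>I. I \<in> S \<Longrightarrow> p \<delta> I \<in> \<P>"
    using p0 p_mem \<delta> by (auto simp: \<P>_def)
  have "ennreal \<delta> \<le> 2 * R + ennreal (\<delta> * (18 / 5) / 4)"
  proof (rule mixture_lower_bound[where S=S and Q=PQ and lik=lik and base_loss="\<l> p0" and loss="\<lambda>I. \<l> (p \<delta> I)"])
    show "0 \<le> lik I \<omega>" if "I \<in> S" for I \<omega>
      unfolding lik_def using g0[OF that] by (intro prod_nonneg) auto
    show "ennreal \<delta> \<le> \<l> p0 \<omega> + \<l> (p \<delta> I) \<omega>" if I: "I \<in> S" and \<omega>: "\<omega> \<in> space PQ" for I \<omega>
    proof -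
      have "ennreal \<delta> \<le> Linf_norm M (\<lambda>x. p0 x - p \<delta> I x)"
      proof (rule Linf_norm_ge)
        show "I \<in> sets M" "0 < emeasure M I" using SM[OF I] block_pos S(3) I by auto
        show "\<delta> \<le> \<bar>p0 x - p \<delta> I x\<bar>" if "x \<in> I" for x
          using that SW[OF I] \<delta>(1) by (auto simp: p0_eq p_def indicator_def)
      qed (use I in measurable)
      also have "\<dots> \<le> \<l> p0 \<omega> + \<l> (p \<delta> I) \<omega>"
        unfolding \<l>_def using I q_meas[OF \<omega>] by (intro Linf_norm_triangle) auto
      finally show ?thesis .
    qed
    show "(\<integral>\<^sup>+\<omega>. \<l> p0 \<omega> \<partial>PQ) \<le> R" using risk[OF mem(1)] by (simp add: law0)
    show "(\<integral>\<^sup>+\<omega>. \<l> (p \<delta> I) \<omega> * ennreal (lik I \<omega>) \<partial>PQ) \<le> R" if I: "I \<in> S" for I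
      using risk[OF mem(2)[OF I]] I \<l>_meas[OF mem(2)[OF I]]
      unfolding law[OF I] by (subst (asm) nn_integral_density) (auto simp: mult.commute)
  qed (use S \<delta> K lik1 \<l>_meas mem in auto)
  then have "ennreal (\<delta> / 20) \<le> R"
  proof (cases R)
    case (real \<rho>)
    with \<open>ennreal \<delta> \<le> _\<close> have "ennreal \<delta> \<le> ennreal (2 * \<rho> + \<delta> * (18 / 5) / 4)"
      using \<delta>(1) by (simp add: ennreal_mult)
    then have "\<delta> \<le> 2 * \<rho> + \<delta> * (18 / 5) / 4" using real \<delta>(1) by (subst (asm) ennreal_le_iff) auto
    then show ?thesis using real by (simp add: ennreal_leI)
  qed simp
  then show ?thesis by (simp add: R_def \<P>_def)
qed

text \<open>Even with infinitely many small blocks, the floor keeps the minimum finite, so a finite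
  family of exactly that size exists. The floor also ensures that height \<open>L\<close> on these
  blocks gives total mass at most one.\<close>

lemma finite_block_selection:
  fixes L h :: real
  assumes "0 < L" "0 < h"
  obtains S where "finite S" "S \<subseteq> {I \<in> \<I>. emeasure M I \<le> ennreal h}"
    "real (card S) = enn2real (min (num_blocks M \<I> h) (of_nat (nat \<lfloor>1 / (L * h)\<rfloor>)))"
    "card S * (L * h) \<le> 1"
proof -
  define B where "B = {I \<in> \<I>. emeasure M I \<le> ennreal h}"
  define k where "k = nat \<lfloor>1 / (L * h)\<rfloor>"
  have "0 \<le> 1 / (L * h)" using assms by simp
  then have "real k \<le> 1 / (L * h)" unfolding k_def by linarith
  then have k: "real k * (L * h) \<le> 1" using assms by (simp add: pos_le_divide_eq)
  have nb: "num_blocks M \<I> h = (if finite B then of_nat (card B) else top)"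
    by (simp add: num_blocks_def B_def emeasure_count_space)
  have sel: "\<exists>S. finite S \<and> S \<subseteq> B \<and> card S = (if finite B \<and> card B \<le> k then card B else k)"
  proof (cases "finite B \<and> card B \<le> k")
    case True
    then show ?thesis by auto
  next
    case False
    show ?thesis
    proof (cases "finite B")
      case True
      then show ?thesis using False obtain_subset_with_card_n[of k B] by (metis linear finite_subset)
    next
      case inf: False
      then show ?thesis using infinite_arbitrarily_large[OF inf, of k] by auto
    qed
  qed
  then obtain S where S: "finite S" "S \<subseteq> B" "card S = (if finite B \<and> card B \<le> k then card B else k)"
    by blast
  have "real (card S) = enn2real (min (num_blocks M \<I> h) (of_nat k))"
    unfolding nb S(3) by (auto simp: min_def ennreal_of_nat_eq_real_of_nat top_unique)
  moreover have "card S * (L * h) \<le> 1"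
  proof -
    have "card S * (L * h) \<le> real k * (L * h)" using assms S(3) by (intro mult_right_mono) auto
    then show ?thesis using k by linarith
  qed
  ultimately show ?thesis using that S by (auto simp: B_def k_def)
qed

theorem theorem2:
  fixes M :: "'a measure" and \<I> :: "'a set set" and n :: nat and L \<theta> :: real
  assumes "sigma_finite_measure M"
    and "countable \<I>" and "partition_on (space M) \<I>" and "\<I> \<subseteq> sets M"
    and "\<And>I. I \<in> \<I> \<Longrightarrow> emeasure M I > 0"
    and "n \<ge> 1" and "L > 0"
    and "1 / 2 < \<theta>" and "\<theta> < 1"
    and "ennreal L \<ge> 1 / (ennreal \<theta> * emeasure M (finite_part M \<I>))"
  shows "minimax_risk M n (block_densities M \<I> L)
    \<ge> ennreal (1 / 40) *
      min (ennreal ((1 - \<theta>) * L)) (ennreal (sqrt (\<theta> * (1 - \<theta>))) * psi M n \<I> L)"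
  unfolding minimax_risk_def
proof (rule INF_greatest)
  fix q assume q: "q \<in> estimators M n (block_densities M \<I> L)"
  let ?R = "sup_risk M n (block_densities M \<I> L) q"
  define \<sigma> where "\<sigma> = sqrt (\<theta> * (1 - \<theta>))"
  have \<theta>: "0 < \<theta>" "\<theta> < 1" using assms by auto
  have \<sigma>: "0 < \<sigma>" "\<sigma>\<^sup>2 = \<theta> * (1 - \<theta>)" using \<theta> by (simp_all add: \<sigma>_def)
  show "ennreal (1 / 40) * min (ennreal ((1 - \<theta>) * L)) (ennreal (sqrt (\<theta> * (1 - \<theta>))) * psi M n \<I> L) \<le> ?R"
  \<comment> \<open>The supremum over \<open>h\<close> need not be attained and may be infinite. A
    strict inequality against it can be transferred to a single \<open>h\<close>, which is why the
    argument goes by contradiction.\<close>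
  proof (rule ccontr)
    assume "\<not> ?thesis"
    then have less: "?R < ennreal (1 / 40) * min (ennreal ((1 - \<theta>) * L)) (ennreal \<sigma> * psi M n \<I> L)"
      by (simp add: not_le \<sigma>_def)
    then obtain \<rho> where \<rho>: "?R = ennreal \<rho>" "0 \<le> \<rho>" by (cases ?R) auto
    \<comment> \<open>The value of \<open>psi\<close> at which the second term of the claimed bound
      would equal \<rho>.\<close>
    define v where "v = 40 * \<rho> / \<sigma>"
    have v0: "0 \<le> v" using \<rho> \<sigma> by (simp add: v_def)
    have "ennreal \<rho> < ennreal (1 / 40) * ennreal ((1 - \<theta>) * L)"
      using less mult_left_mono[OF min.cobounded1, of "ennreal (1 / 40)"] unfolding \<rho>
      by (meson less_le_trans zero_le)
    also have "\<dots> = ennreal (1 / 40 * ((1 - \<theta>) * L))" using assms by (subst ennreal_mult) auto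
    finally have \<rho>L: "40 * \<rho> < (1 - \<theta>) * L" using \<rho>(2) by (simp add: ennreal_less_iff)
    have "ennreal \<rho> < ennreal (1 / 40) * (ennreal \<sigma> * psi M n \<I> L)"
      using less mult_left_mono[OF min.cobounded2, of "ennreal (1 / 40)"] unfolding \<rho>
      by (meson less_le_trans zero_le)
    then have v_psi: "ennreal v < psi M n \<I> L"
    proof (cases "psi M n \<I> L")
      case (real t)
      assume "ennreal \<rho> < ennreal (1 / 40) * (ennreal \<sigma> * psi M n \<I> L)"
      also have "\<dots> = ennreal (1 / 40 * (\<sigma> * t))"
        using real \<sigma> by (simp only: ennreal_mult[symmetric]) (simp flip: ennreal_mult)
      finally have "\<rho> < 1 / 40 * (\<sigma> * t)" using \<rho>(2) by (simp add: ennreal_less_iff)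
      then have "v < t" using \<sigma> by (simp add: v_def pos_divide_less_eq mult.commute)
      then show ?thesis using real v0 by (simp add: ennreal_less_iff)
    qed simp
    have "ennreal (v\<^sup>2) < psi_sq M n \<I> L"
      unfolding psi_power2[symmetric]
    proof (cases "psi M n \<I> L")
      case (real t)
      then have "v < t" using v_psi v0 by (simp add: ennreal_less_iff)
      then have "v\<^sup>2 < t\<^sup>2" using v0 by (intro power_strict_mono) auto
      then show "ennreal (v\<^sup>2) < (psi M n \<I> L)\<^sup>2"
        using real by (simp add: ennreal_power ennreal_less_iff)
    qed (simp add: power2_eq_square ennreal_top_mult)
    then obtain h where h: "0 < h" and v_h: "ennreal (v\<^sup>2) < ennreal (L / (h * real n) *
        ln (1 + enn2real (min (num_blocks M \<I> h) (of_nat (nat \<lfloor>1 / (L * h)\<rfloor>)))))"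
      unfolding psi_sq_def less_SUP_iff by auto
    obtain S where S: "finite S" "S \<subseteq> {I \<in> \<I>. emeasure M I \<le> ennreal h}"
      "real (card S) = enn2real (min (num_blocks M \<I> h) (of_nat (nat \<lfloor>1 / (L * h)\<rfloor>)))"
      "card S * (L * h) \<le> 1"
      using finite_block_selection[OF \<open>L > 0\<close> h] by metis
    have v_lt: "v\<^sup>2 < L / (h * real n) * ln (1 + card S)"
      using v_h unfolding S(3)[symmetric] by (simp add: ennreal_less_iff)
    \<comment> \<open>For an empty family the logarithm is \<open>ln 1 = 0\<close>, which cannot
      strictly exceed a square.\<close>
    have "S \<noteq> {}"
    proof
      assume "S = {}"
      then have "v\<^sup>2 < 0" using v_lt by simp
      then show False by simp
    qed
    define D where "D = min ((1 - \<theta>) * L) (\<sigma> * sqrt (L / (h * real n) * ln (1 + card S)))"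
    have D0: "0 \<le> D" using \<theta> \<sigma> assms h by (auto simp: D_def)
    have D2: "D\<^sup>2 \<le> \<theta> * (1 - \<theta>) * (L / (h * real n) * ln (1 + card S))"
    proof -
      have "D\<^sup>2 \<le> (\<sigma> * sqrt (L / (h * real n) * ln (1 + card S)))\<^sup>2"
        using D0 by (intro power_mono) (auto simp: D_def)
      also have "\<dots> = \<sigma>\<^sup>2 * (L / (h * real n) * ln (1 + card S))"
        using assms h by (simp add: power_mult_distrib)
      finally show ?thesis unfolding \<sigma>(2) .
    qed
    \<comment> \<open>Halving \<open>D\<close> supplies the factor \<open>1 / 4\<close> required of
      the squared separation, and turns \<open>1 / 20\<close> into the final
      \<open>1 / 40\<close>.\<close>
    have "ennreal (D / 2 / 20) \<le> ?R"
    proof (rule sup_risk_ge_separation[OF assms(2-5) \<open>L > 0\<close> \<theta> h assms(10) S(1) \<open>S \<noteq> {}\<close> _ _ S(4) _ _ _ q])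
      show "D / 2 \<le> (1 - \<theta>) * L" using D0 by (auto simp: D_def)
      have "n * (D / 2)\<^sup>2 * h = n * h * D\<^sup>2 / 4" by (simp add: power2_eq_square)
      also have "\<dots> \<le> n * h * (\<theta> * (1 - \<theta>) * (L / (h * real n) * ln (1 + card S))) / 4"
        using D2 h by (intro divide_right_mono mult_left_mono) auto
      also have "\<dots> = L * \<theta> * (1 - \<theta>) * ln (1 + card S) / 4"
        using h assms by (simp add: field_simps)
      finally show "n * (D / 2)\<^sup>2 * h \<le> L * \<theta> * (1 - \<theta>) * ln (1 + card S) / 4" .
    qed (use S D0 in auto)
    then have "D \<le> 40 * \<rho>" unfolding \<rho>(1) using \<rho>(2) by (simp add: ennreal_le_iff)
    \<comment> \<open>Both terms of the minimum exceed \<open>40 * \<rho>\<close>: the first by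
      assumption, the second by the choice of \<open>h\<close>.\<close>
    moreover have "40 * \<rho> < D"
    proof -
      have "v < sqrt (L / (h * real n) * ln (1 + card S))" using v_lt by (rule real_less_rsqrt)
      then have "40 * \<rho> < \<sigma> * sqrt (L / (h * real n) * ln (1 + card S))"
        using \<sigma> by (simp add: v_def pos_divide_less_eq mult.commute)
      then show ?thesis using \<rho>L by (simp add: D_def)
    qed
    ultimately show False by simp
  qed
qed

end
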